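(* Let $Y$ be the class label, taking values in the finite set $\mathcal{C}=\{1,\dots,K\}$, let $\mathcal{G}_{sub}$ be the (random) significant subgraph of a graph $\mathcal{G}$, let $\mathcal{G}_{p}$ be the (random) prototype graph, and let $\gamma$ be a similarity function, so that $\gamma(\mathcal{G}_{sub},\mathcal{G}_{p})$ is a random variable. Let $q_\theta(\cdot\mid s)$ be a variational approximation to the true posterior $p(\cdot\mid \gamma(\mathcal{G}_{sub},\mathcal{G}_{p})=s)$, i.e. for each value $s$ of $\gamma$, $q_\theta(\cdot\mid s)$ is a probability mass function on $\mathcal{C}$ depending measurably on $s$. Then $$ \begin{aligned} I(Y;\mathcal{G}_{sub},\mathcal{G}_{p}) &=\mathbb{E}_{Y,\mathcal{G}_{sub},\mathcal{G}_{p}}\left[\log p\left(Y\mid \mathcal{G}_{sub},\mathcal{G}_{p}\right)\right]-\mathbb{E}_{Y}\left[\log p(Y)\right]\\ &\ge \mathbb{E}_{Y,\mathcal{G}_{sub},\mathcal{G}_{p}}\left[\log p\left(Y\mid \gamma(\mathcal{G}_{sub},\mathcal{G}_{p})\right)\right]-\mathbb{E}_{Y}\left[\log p(Y)\right]\\ &\ge \mathbb{E}_{Y,\mathcal{G}_{sub},\mathcal{G}_{p}}\left[\log q_\theta\left(Y\mid \gamma(\mathcal{G}_{sub},\mathcal{G}_{p})\right)\right]. \end{aligned} $$ The last quantity is denoted $-\mathcal{L}_{\mathrm{cls}}\left(q_\theta\left(Y\mid\gamma(\mathcal{G}_{sub},\mathcal{G}_{p})\right)\right)$, so that $I(Y;\mathcal{G}_{sub},\mathcal{G}_{p})\ge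 -\mathcal{L}_{\mathrm{cls}}$.
   Context: All random variables are defined on a common probability space. $Y$ takes values in the finite set $\mathcal{C}=\{1,\dots,K\}$; $\mathcal{G}_{sub}$ and $\mathcal{G}_{p}$ take values in measurable spaces (of graphs, or of their vector representations); $\gamma$ is a measurable function of the pair $(\mathcal{G}_{sub},\mathcal{G}_{p})$ with values in some $\mathbb{R}^d$. $p(Y)$ denotes the probability mass function of $Y$. $p(Y\mid \mathcal{G}_{sub},\mathcal{G}_{p})$ and $p(Y\mid\gamma(\mathcal{G}_{sub},\mathcal{G}_{p}))$ denote the conditional probability mass functions of $Y$ given $(\mathcal{G}_{sub},\mathcal{G}_{p})$ and given $\gamma(\mathcal{G}_{sub},\mathcal{G}_{p})$ respectively, evaluated at the random value $Y$. $\mathbb{E}_{Y,\mathcal{G}_{sub},\mathcal{G}_{p}}$ is expectation under the joint law and $\mathbb{E}_Y$ is expectation under the law of $Y$. The convention $\log 0=-\infty$ is used, so the last expectation takes values in $[-\infty,0]$. The mutual information of random variables $X$ and $Y$ is $I(X;Y)=\int\int p(x,y)\log\frac{p(x,y)}{p(x)p(y)}\,dx\,dy$, where $p(x,y)$, $p(x)$, $p(y)$ are the joint and marginal densities with respect to suitable reference measures (counting measure for discrete variables); equivalently, it is the Kullback–Leibler divergence of the joint law from the product of the marginal laws. $I(Y;\mathcal{G}_{sub},\mathcal{G}_{p})$ is the mutual information between $Y$ and the pair $(\mathcal{G}_{sub},\mathcal{G}_{p})$. *)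

theory Defs
  imports "HOL-Probability.Probability"
begin

definition ln_ext :: "real \<Rightarrow> ereal" where
  "ln_ext x = (if 0 < x then ereal (ln x) else - \<infinity>)"

(* The Bochner integral of the library is 0 on non-integrable functions, so expectations of
   logarithms, which may be infinite, are taken as E[f^+] - E[f^-] in the extended reals.
   The conversion e2ennreal sends negative numbers to 0. *)
definition ext_expectation :: "'a measure \<Rightarrow> ('a \<Rightarrow> ereal) \<Rightarrow> ereal" where
  "ext_expectation M f =
     enn2ereal (\<integral>\<^sup>+x. e2ennreal (f x) \<partial>M) - enn2ereal (\<integral>\<^sup>+x. e2ennreal (- f x) \<partial>M)"

definition pmf_kernel :: "'c set \<Rightarrow> 's measure \<Rightarrow> ('s \<Rightarrow> 'c pmf) \<Rightarrow> bool" where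
  "pmf_kernel C S k \<longleftrightarrow>
     (\<forall>s\<in>space S. set_pmf (k s) \<subseteq> C) \<and> (\<forall>c\<in>C. (\<lambda>s. pmf (k s) c) \<in> borel_measurable S)"

(* k is a (regular) version of the conditional probability mass function p(. | X = s).
   Versions exist (lemma ex_conditional_pmf) and agree for almost all s under the law of X. *)
definition conditional_pmf ::
  "'w measure \<Rightarrow> 'c set \<Rightarrow> ('w \<Rightarrow> 'c) \<Rightarrow> 's measure \<Rightarrow> ('w \<Rightarrow> 's) \<Rightarrow> ('s \<Rightarrow> 'c pmf) \<Rightarrow> bool" where
  "conditional_pmf M C Y S X k \<longleftrightarrow>
     pmf_kernel C S k \<and>
     (\<forall>c\<in>C. \<forall>A\<in>sets S.
        measure M {w \<in> space M. Y w = c \<and> X w \<in> A} = (LINT s:A|distr M S X. pmf (k s) c))"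

(* The classification loss: expected negative log-likelihood under the joint law N of the label
   and the features x, for the predicted label distribution r x. *)
definition cls_loss :: "('c \<times> 'x) measure \<Rightarrow> ('x \<Rightarrow> 'c pmf) \<Rightarrow> ereal" where
  "cls_loss N r = - ext_expectation N (\<lambda>(y, x). ln_ext (pmf (r x) y))"

lemma ex_conditional_pmf:
  assumes "prob_space M" and fin: "finite C"
    and Y[measurable]: "Y \<in> measurable M (count_space C)" and X[measurable]: "X \<in> measurable M S"
  shows "\<exists>k. conditional_pmf M C Y S X k"
proof -
  interpret prob_space M by fact
  define N where "N = distr M S X"
  interpret N: prob_space N unfolding N_def by (rule prob_space_distr) fact
  have sN[simp]: "sets N = sets S" "space N = space S" by (simp_all add: N_def)
  have mN: "measurable N = (measurable S :: 'd measure \<Rightarrow> _)" by (intro ext measurable_cong_sets) auto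
  obtain w where w: "w \<in> space M" using not_empty by blast
  then have c0: "Y w \<in> C" using measurable_space[OF Y w] by simp
  define E where "E c = {w \<in> space M. Y w = c}" for c
  have E[measurable]: "E c \<in> sets M" if "c \<in> C" for c
  proof -
    have "E c = Y -` {c} \<inter> space M" by (auto simp: E_def)
    then show ?thesis using measurable_sets[OF Y, of "{c}"] that by simp
  qed
  define V where "V c = distr (density M (indicator (E c))) S X" for c
  have V: "emeasure (V c) A = emeasure M {w \<in> space M. Y w = c \<and> X w \<in> A}"
    if c: "c \<in> C" and A: "A \<in> sets S" for c A
  proof -
    have XA: "X -` A \<inter> space M \<in> sets M" using measurable_sets[OF X A] .
    have "emeasure (V c) A = emeasure (density M (indicator (E c))) (X -` A \<inter> space M)"
      unfolding V_def using A X by (subst emeasure_distr) auto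
    also have "\<dots> = (\<integral>\<^sup>+x. indicator (E c) x * indicator (X -` A \<inter> space M) x \<partial>M)"
      using E[OF c] XA by (subst emeasure_density) auto
    also have "\<dots> = (\<integral>\<^sup>+x. indicator (E c \<inter> (X -` A \<inter> space M)) x \<partial>M)"
      by (intro nn_integral_cong) (auto split: split_indicator)
    also have "\<dots> = emeasure M (E c \<inter> (X -` A \<inter> space M))"
      using E[OF c] XA by simp
    also have "E c \<inter> (X -` A \<inter> space M) = {w \<in> space M. Y w = c \<and> X w \<in> A}"
      by (auto simp: E_def)
    finally show ?thesis .
  qed
  have N: "emeasure N A = emeasure M (X -` A \<inter> space M)" if "A \<in> sets S" for A
    unfolding N_def using that X by (subst emeasure_distr) auto
  have "\<exists>f \<in> borel_measurable N. density N f = V c" if c: "c \<in> C" for c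
  proof (rule N.Radon_Nikodym)
    show "absolutely_continuous N (V c)"
    proof (unfold absolutely_continuous_def, rule subsetI)
      fix A assume "A \<in> null_sets N"
      then have A: "A \<in> sets S" and 0: "emeasure M (X -` A \<inter> space M) = 0"
        using N by (auto simp: null_sets_def)
      have "emeasure (V c) A \<le> emeasure M (X -` A \<inter> space M)"
        unfolding V[OF c A] using measurable_sets[OF X A] by (intro emeasure_mono) auto
      then show "A \<in> null_sets (V c)" using 0 A by (auto simp: null_sets_def V_def)
    qed
  qed (simp add: V_def)
  then have "\<forall>c\<in>C. \<exists>f. f \<in> borel_measurable S \<and> density N f = V c" by (auto simp: mN)
  then obtain f where f[measurable]: "\<And>c. c \<in> C \<Longrightarrow> f c \<in> borel_measurable S"
    and fV: "\<And>c. c \<in> C \<Longrightarrow> density N (f c) = V c" by metis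
  have fV': "(\<integral>\<^sup>+s. f c s * indicator A s \<partial>N) = emeasure (V c) A" if "c \<in> C" "A \<in> sets S" for c A
    using that f by (subst fV[symmetric]) (auto simp: emeasure_density mN)
  have "density N (\<lambda>s. \<Sum>c\<in>C. f c s) = density N (\<lambda>_. 1)"
  proof (rule measure_eqI)
    fix A assume "A \<in> sets (density N (\<lambda>s. \<Sum>c\<in>C. f c s))"
    then have A: "A \<in> sets S" by simp
    have "emeasure (density N (\<lambda>s. \<Sum>c\<in>C. f c s)) A = (\<integral>\<^sup>+s. (\<Sum>c\<in>C. f c s * indicator A s) \<partial>N)"
      using A f by (subst emeasure_density) (auto simp: mN sum_distrib_right)
    also have "\<dots> = (\<Sum>c\<in>C. \<integral>\<^sup>+s. f c s * indicator A s \<partial>N)"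
      using A f by (subst nn_integral_sum) (auto simp: mN)
    also have "\<dots> = (\<Sum>c\<in>C. emeasure M {w \<in> space M. Y w = c \<and> X w \<in> A})"
      using A by (intro sum.cong) (auto simp: fV' V)
    also have "\<dots> = emeasure M (\<Union>c\<in>C. {w \<in> space M. Y w = c \<and> X w \<in> A})"
    proof (rule sum_emeasure)
      show "(\<lambda>c. {w \<in> space M. Y w = c \<and> X w \<in> A}) ` C \<subseteq> sets M"
      proof safe
        fix c assume "c \<in> C"
        have "{w \<in> space M. Y w = c \<and> X w \<in> A} = E c \<inter> (X -` A \<inter> space M)"
          by (auto simp: E_def)
        then show "{w \<in> space M. Y w = c \<and> X w \<in> A} \<in> sets M"
          using E[OF \<open>c \<in> C\<close>] measurable_sets[OF X A] by simp
      qed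
    qed (auto simp: disjoint_family_on_def fin)
    also have "(\<Union>c\<in>C. {w \<in> space M. Y w = c \<and> X w \<in> A}) = X -` A \<inter> space M"
      using measurable_space[OF Y] by auto
    also have "emeasure M \<dots> = emeasure (density N (\<lambda>_. 1)) A"
      using A by (simp add: N density_1)
    finally show "emeasure (density N (\<lambda>s. \<Sum>c\<in>C. f c s)) A = emeasure (density N (\<lambda>_. 1)) A" .
  qed simp
  then have ae: "AE s in N. (\<Sum>c\<in>C. f c s) = 1"
    using f by (subst (asm) N.density_unique_iff) (auto simp: mN)
  define g where "g s c = (if (\<Sum>c\<in>C. f c s) = 1 then if c \<in> C then enn2real (f c s) else 0
      else if c = Y w then 1 else 0)" for s c
  have g0: "0 \<le> g s c" for s c by (simp add: g_def)
  have f_fin: "f c s \<noteq> \<top>" if "(\<Sum>c\<in>C. f c s) = 1" "c \<in> C" for s c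
    using member_le_sum[of c C "\<lambda>c. f c s"] that fin by (auto simp: top_unique)
  have g1: "(\<Sum>c\<in>C. ennreal (g s c)) = 1" for s
  proof (cases "(\<Sum>c\<in>C. f c s) = 1")
    case True
    then have "(\<Sum>c\<in>C. ennreal (g s c)) = (\<Sum>c\<in>C. f c s)"
      using f_fin[OF True] by (intro sum.cong) (auto simp: g_def less_top)
    then show ?thesis using True by simp
  next
    case False
    have "(\<Sum>c\<in>C. ennreal (g s c)) = (\<Sum>c\<in>C. if c = Y w then 1 else 0)"
      using False by (intro sum.cong) (auto simp: g_def)
    then show ?thesis using fin c0 by simp
  qed
  have gC: "g s c = 0" if "c \<notin> C" for s c using that c0 by (auto simp: g_def)
  have "(\<integral>\<^sup>+c. ennreal (g s c) \<partial>count_space UNIV) = 1" for s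
    using gC fin by (subst nn_integral_count_space'[of C]) (auto simp: g1)
  then have pk: "pmf (embed_pmf (g s)) c = g s c" for s c
    using g0 by (intro pmf_embed_pmf) auto
  have gm[measurable]: "(\<lambda>s. g s c) \<in> borel_measurable S" if "c \<in> C" for c
    using that f unfolding g_def by measurable
  have "conditional_pmf M C Y S X (\<lambda>s. embed_pmf (g s))"
    unfolding conditional_pmf_def pmf_kernel_def
  proof (intro conjI ballI)
    fix s assume "s \<in> space S"
    show "set_pmf (embed_pmf (g s)) \<subseteq> C" using gC by (auto simp: set_pmf_eq pk)
  next
    fix c assume "c \<in> C"
    then show "(\<lambda>s. pmf (embed_pmf (g s)) c) \<in> borel_measurable S" using gm by (simp add: pk)
  next
    fix c A assume c: "c \<in> C" and A: "A \<in> sets S"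
    have "(LINT s:A|N. g s c) = enn2real (\<integral>\<^sup>+s. ennreal (indicator A s * g s c) \<partial>N)"
      unfolding set_lebesgue_integral_def real_scaleR_def
      using g0 gm[OF c] A by (intro integral_eq_nn_integral) (auto simp: mN)
    also have "(\<integral>\<^sup>+s. ennreal (indicator A s * g s c) \<partial>N) = (\<integral>\<^sup>+s. f c s * indicator A s \<partial>N)"
      using ae f_fin c
      by (intro nn_integral_cong_AE) (auto simp: g_def less_top split: split_indicator)
    also have "\<dots> = emeasure M {w \<in> space M. Y w = c \<and> X w \<in> A}"
      using c A by (simp add: fV' V)
    finally show "measure M {w \<in> space M. Y w = c \<and> X w \<in> A}
        = (LINT s:A|distr M S X. pmf (embed_pmf (g s)) c)"
      by (simp add: pk N_def measure_def)
  qed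
  then show ?thesis by blast
qed

end

theory Submission
  imports Defs
begin

text \<open>Both inequalities are instances of one fact: given a feature \<open>X\<close>, the true posterior \<open>k\<close> maximises
  \<open>E[ln r(Y | X)]\<close> over all kernels \<open>r\<close> (Gibbs' inequality). For \<open>X = (G_sub, G_p)\<close> it is applied to the
  kernel \<open>p_\<gamma> \<circ> \<gamma>\<close>, for \<open>X = \<gamma>(G_sub, G_p)\<close> to \<open>q\<close>; the term \<open>- E[ln p(Y)]\<close> is nonnegative and may be dropped.
  Comparison with the uniform kernel shows that \<open>E[ln k(Y | X)]\<close> is finite. The mutual information is computed
  from the density \<open>k(y | x) / p(y)\<close> of the joint law with respect to the product of the marginals.\<close>

section \<open>Negative log-likelihood with values in \<open>[0, \<infinity>]\<close>\<close>

definition nll :: "real \<Rightarrow> ennreal" where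
  "nll u = e2ennreal (- ln_ext u)"

lemma nll_pos: "0 < u \<Longrightarrow> nll u = ennreal (- ln u)"
  by (simp add: nll_def ln_ext_def ennreal.abs_eq)

lemma nll_nonpos: "u \<le> 0 \<Longrightarrow> nll u = \<infinity>"
  by (simp add: nll_def ln_ext_def)

lemma nll_measurable[measurable]: "nll \<in> borel_measurable borel"
proof -
  have "nll = (\<lambda>u. if 0 < u then ennreal (- ln u) else \<infinity>)"
    by (auto simp: nll_pos nll_nonpos)
  moreover have "\<dots> \<in> borel_measurable borel" by measurable
  ultimately show ?thesis by simp
qed

text \<open>A logarithm of something at most 1 has no positive part, so the difference defining
  \<open>ext_expectation\<close> never takes the form \<infinity> - \<infinity>. Inequalities can
  thus be proved for nonnegative integrals of \<open>nll\<close> and negated at the end.\<close>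

lemma ext_expectation_ln_ext:
  assumes "\<And>x. u x \<le> 1"
  shows "ext_expectation M (\<lambda>x. ln_ext (u x)) = - enn2ereal (\<integral>\<^sup>+x. nll (u x) \<partial>M)"
proof -
  have "e2ennreal (ln_ext (u x)) = 0" for x
    using assms[of x] by (auto simp: ln_ext_def ennreal_neg e2ennreal_neg)
  then show ?thesis by (simp add: ext_expectation_def nll_def zero_ennreal.rep_eq)
qed

text \<open>The bridge back to the Bochner integral: \<open>nll\<close> is infinite wherever
  \<open>u\<close> is not positive, so a finite integral forces \<open>u\<close> to be positive
  almost everywhere, and there \<open>nll\<close> is the ordinary \<open>- ln\<close>.\<close>

lemma
  assumes [measurable]: "u \<in> borel_measurable M"
    and le: "\<And>x. u x \<le> 1" and fin: "(\<integral>\<^sup>+x. nll (u x) \<partial>M) < \<infinity>"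
  shows AE_pos_if_nll_finite: "AE x in M. 0 < u x"
    and integrable_ln_if_nll_finite: "integrable M (\<lambda>x. ln (u x))"
    and ext_expectation_ln_if_nll_finite:
      "ext_expectation M (\<lambda>x. ln_ext (u x)) = ereal (\<integral>x. ln (u x) \<partial>M)"
proof -
  have "AE x in M. nll (u x) \<noteq> \<infinity>"
    using fin by (intro nn_integral_noteq_infinite) auto
  then show pos: "AE x in M. 0 < u x"
    by eventually_elim (metis nll_nonpos not_less)
  then have eq: "(\<integral>\<^sup>+x. nll (u x) \<partial>M) = (\<integral>\<^sup>+x. ennreal (- ln (u x)) \<partial>M)"
    by (intro nn_integral_cong_AE) (auto elim!: eventually_mono simp: nll_pos)
  have nonneg: "AE x in M. 0 \<le> - ln (u x)"
    using pos by eventually_elim (use le in simp)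
  have int: "integrable M (\<lambda>x. - ln (u x))"
    using fin nonneg by (intro integrableI_nonneg) (auto simp: eq)
  then show "integrable M (\<lambda>x. ln (u x))"
    by simp
  have "(\<integral>\<^sup>+x. nll (u x) \<partial>M) = ennreal (\<integral>x. - ln (u x) \<partial>M)"
    unfolding eq by (rule nn_integral_eq_integral[OF int nonneg])
  moreover have "0 \<le> (\<integral>x. - ln (u x) \<partial>M)"
    using nonneg by (rule integral_nonneg_AE)
  ultimately show "ext_expectation M (\<lambda>x. ln_ext (u x)) = ereal (\<integral>x. ln (u x) \<partial>M)"
    using le by (simp add: ext_expectation_ln_ext enn2ereal_ennreal)
qed

section \<open>Label kernels and integration against the joint law of label and feature\<close>

lemma pmf_kernel_measurable:
  assumes "finite C" and "pmf_kernel C S r"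
  shows "(\<lambda>(y, s). pmf (r s) y) \<in> borel_measurable (count_space C \<Otimes>\<^sub>M S)"
proof (rule measurable_pair_measure_countable1)
  show "countable C"
    using assms(1) by (rule countable_finite)
qed (use assms(2) in \<open>auto simp: pmf_kernel_def\<close>)

text \<open>The feature \<open>X\<close> is left abstract because the results are needed for two
  features on the same space \<open>M\<close>: the pair of graphs and its image under
  \<gamma>.\<close>

locale label_posterior = prob_space M
  for M :: "'w measure" and C :: "'c set" and Y :: "'w \<Rightarrow> 'c"
    and S :: "'s measure" and X :: "'w \<Rightarrow> 's" and k :: "'s \<Rightarrow> 'c pmf" +
  assumes finite_labels: "finite C"
    and Y[measurable]: "Y \<in> measurable M (count_space C)"
    and X[measurable]: "X \<in> measurable M S"
    and posterior: "conditional_pmf M C Y S X k"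
begin

abbreviation "law_X \<equiv> distr M S X"

abbreviation "law_Y \<equiv> distr M (count_space C) Y"

lemma pmf_kernel_posterior: "pmf_kernel C S k"
  using posterior by (simp add: conditional_pmf_def)

lemma posterior_measurable: "c \<in> C \<Longrightarrow> (\<lambda>s. pmf (k s) c) \<in> borel_measurable S"
  using pmf_kernel_posterior by (simp add: pmf_kernel_def)

lemma Y_in_labels: "w \<in> space M \<Longrightarrow> Y w \<in> C"
  using measurable_space[OF Y] by simp

lemma kernel_measurable_comp:
  assumes "pmf_kernel C S r"
  shows "(\<lambda>w. pmf (r (X w)) (Y w)) \<in> borel_measurable M"
  using measurable_compose[OF _ pmf_kernel_measurable[OF finite_labels assms], of "\<lambda>w. (Y w, X w)" M]
  by simp

lemma label_event: "c \<in> C \<Longrightarrow> {w \<in> space M. Y w = c} \<in> sets M"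
  using measurable_sets[OF Y, of "{c}"]
  by (auto simp: vimage_def Int_def conj_commute)

text \<open>On a set \<open>A\<close> both measures give the probability that \<open>Y = c\<close>
  and \<open>X\<close> lies in \<open>A\<close>, which is the defining identity of
  \<open>conditional_pmf\<close>. As an equality of measures it extends from sets to all nonnegative
  integrands.\<close>

lemma distr_label_event:
  assumes c: "c \<in> C"
  shows "distr (density M (indicator {w \<in> space M. Y w = c})) S X
    = density law_X (\<lambda>s. ennreal (pmf (k s) c))" (is "?L = ?R")
proof (rule measure_eqI)
  note [measurable] = posterior_measurable[OF c] label_event[OF c]
  fix A assume "A \<in> sets ?L"
  then have A[measurable]: "A \<in> sets S" by simp
  have XA[measurable]: "X -` A \<inter> space M \<in> sets M"
    by (rule measurable_sets[OF X A])
  have "emeasure ?L A = (\<integral>\<^sup>+w. indicator {w \<in> space M. Y w = c} w * indicator (X -` A \<inter> space M) w \<partial>M)"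
    by (simp add: emeasure_distr emeasure_density)
  also have "\<dots> = (\<integral>\<^sup>+w. indicator {w \<in> space M. Y w = c \<and> X w \<in> A} w \<partial>M)"
    by (intro nn_integral_cong) (auto split: split_indicator)
  also have "\<dots> = emeasure M {w \<in> space M. Y w = c \<and> X w \<in> A}"
  proof (rule nn_integral_indicator)
    have "{w \<in> space M. Y w = c \<and> X w \<in> A} = {w \<in> space M. Y w = c} \<inter> (X -` A \<inter> space M)"
      by auto
    then show "{w \<in> space M. Y w = c \<and> X w \<in> A} \<in> sets M" by simp
  qed
  also have "\<dots> = ennreal (LINT s:A|law_X. pmf (k s) c)"
    using posterior c A by (simp add: conditional_pmf_def emeasure_eq_measure)
  \<comment> \<open>The integrand is bounded by 1 on a probability space, hence integrable, so the
    Bochner integral agrees with the nonnegative one.\<close>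
  also have "\<dots> = (\<integral>\<^sup>+s. ennreal (indicator A s * pmf (k s) c) \<partial>law_X)"
  proof -
    interpret N: prob_space law_X by (rule prob_space_distr) (rule X)
    show ?thesis
      unfolding set_lebesgue_integral_def real_scaleR_def
      by (intro nn_integral_eq_integral[symmetric] N.integrable_const_bound[of _ 1])
        (auto simp: pmf_le_1 split: split_indicator)
  qed
  also have "\<dots> = emeasure ?R A"
    by (subst emeasure_density)
      (auto intro!: nn_integral_cong split: split_indicator)
  finally show "emeasure ?L A = emeasure ?R A" .
qed simp

lemma nn_integral_label:
  assumes c: "c \<in> C" and f[measurable]: "f \<in> borel_measurable S"
  shows "(\<integral>\<^sup>+w. indicator {w \<in> space M. Y w = c} w * f (X w) \<partial>M)
    = (\<integral>\<^sup>+s. ennreal (pmf (k s) c) * f s \<partial>law_X)"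
proof -
  note [measurable] = posterior_measurable[OF c] label_event[OF c]
  have "(\<integral>\<^sup>+w. indicator {w \<in> space M. Y w = c} w * f (X w) \<partial>M)
    = (\<integral>\<^sup>+s. f s \<partial>distr (density M (indicator {w \<in> space M. Y w = c})) S X)"
    by (subst nn_integral_distr) (auto simp: nn_integral_density)
  also have "\<dots> = (\<integral>\<^sup>+s. ennreal (pmf (k s) c) * f s \<partial>law_X)"
    unfolding distr_label_event[OF c] by (subst nn_integral_density) auto
  finally show ?thesis .
qed

text \<open>Disintegration of the joint law: the integrand is split along the finitely many events
  \<open>Y = c\<close>, and each piece is integrated against the posterior weight of
  \<open>c\<close>. Later expectations over \<open>M\<close> are evaluated through this formula, and
  in \<open>joint_density\<close> it is also read backwards.\<close>

lemma nn_integral_joint: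
  assumes h: "\<And>c. c \<in> C \<Longrightarrow> h c \<in> borel_measurable S"
  shows "(\<integral>\<^sup>+w. h (Y w) (X w) \<partial>M) = (\<Sum>c\<in>C. \<integral>\<^sup>+s. ennreal (pmf (k s) c) * h c s \<partial>law_X)"
proof -
  have "(\<integral>\<^sup>+w. h (Y w) (X w) \<partial>M)
    = (\<integral>\<^sup>+w. (\<Sum>c\<in>C. indicator {w \<in> space M. Y w = c} w * h c (X w)) \<partial>M)"
  proof (rule nn_integral_cong)
    fix w assume w: "w \<in> space M"
    have "(\<Sum>c\<in>C. indicator {w \<in> space M. Y w = c} w * h c (X w))
      = (\<Sum>c\<in>C. if c = Y w then h c (X w) else 0)"
      using w by (intro sum.cong) auto
    then show "h (Y w) (X w) = (\<Sum>c\<in>C. indicator {w \<in> space M. Y w = c} w * h c (X w))"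
      using finite_labels Y_in_labels[OF w] by simp
  qed
  also have "\<dots> = (\<Sum>c\<in>C. \<integral>\<^sup>+w. indicator {w \<in> space M. Y w = c} w * h c (X w) \<partial>M)"
  proof (rule nn_integral_sum)
    fix c assume c: "c \<in> C"
    note [measurable] = h[OF c] label_event[OF c]
    show "(\<lambda>w. indicator {w \<in> space M. Y w = c} w * h c (X w)) \<in> borel_measurable M"
      by measurable
  qed
  also have "\<dots> = (\<Sum>c\<in>C. \<integral>\<^sup>+s. ennreal (pmf (k s) c) * h c s \<partial>law_X)"
    using h by (intro sum.cong nn_integral_label) auto
  finally show ?thesis .
qed

section \<open>Gibbs' inequality\<close>

text \<open>After disintegration, the indicator of a vanishing posterior is multiplied by that same
  posterior, so every summand is 0.\<close>

lemma AE_posterior_pos: "AE w in M. 0 < pmf (k (X w)) (Y w)"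
proof -
  note [measurable] = kernel_measurable_comp[OF pmf_kernel_posterior]
  have "(\<integral>\<^sup>+w. indicator {0} (pmf (k (X w)) (Y w)) \<partial>M)
    = (\<Sum>c\<in>C. \<integral>\<^sup>+s. ennreal (pmf (k s) c) * indicator {0} (pmf (k s) c) \<partial>law_X)"
    using posterior_measurable
    by (intro nn_integral_joint[of "\<lambda>c s. indicator {0} (pmf (k s) c)"])
      (auto intro!: measurable_compose[OF _ borel_measurable_indicator])
  also have "\<dots> = (\<Sum>c\<in>C. \<integral>\<^sup>+s. 0 \<partial>law_X)"
    by (intro sum.cong nn_integral_cong) (auto split: split_indicator)
  finally have "(\<integral>\<^sup>+w. indicator {0} (pmf (k (X w)) (Y w)) \<partial>M) = (0 :: ennreal)"
    by simp
  then have "AE w in M. (indicator {0} (pmf (k (X w)) (Y w)) :: ennreal) = 0"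
    by (subst (asm) nn_integral_0_iff_AE) simp_all
  then show ?thesis
    by eventually_elim (auto simp: less_le split: split_indicator_asm)
qed

text \<open>Weighting \<open>r / k\<close> by the posterior \<open>k\<close> leaves at most
  \<open>r\<close>, whose masses sum to 1 over \<open>C\<close>. This bounds the ratio term in
  Gibbs' inequality.\<close>

lemma nn_integral_likelihood_ratio_le:
  assumes r: "pmf_kernel C S r"
  shows "(\<integral>\<^sup>+w. ennreal (pmf (r (X w)) (Y w) / pmf (k (X w)) (Y w)) \<partial>M) \<le> 1"
proof -
  have rm: "(\<lambda>s. pmf (r s) c) \<in> borel_measurable S" if "c \<in> C" for c
    using r that by (simp add: pmf_kernel_def)
  interpret N: prob_space law_X by (rule prob_space_distr) (rule X)
  have "(\<integral>\<^sup>+w. ennreal (pmf (r (X w)) (Y w) / pmf (k (X w)) (Y w)) \<partial>M)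
    = (\<Sum>c\<in>C. \<integral>\<^sup>+s. ennreal (pmf (k s) c) * ennreal (pmf (r s) c / pmf (k s) c) \<partial>law_X)"
    using rm posterior_measurable
    by (intro nn_integral_joint[of "\<lambda>c s. ennreal (pmf (r s) c / pmf (k s) c)"]) auto
  \<comment> \<open>Only an inequality: where \<open>k\<close> vanishes, division by zero gives 0
    and the mass of \<open>r\<close> there is lost.\<close>
  also have "\<dots> \<le> (\<Sum>c\<in>C. \<integral>\<^sup>+s. ennreal (pmf (r s) c) \<partial>law_X)"
    by (intro sum_mono nn_integral_mono) (auto simp flip: ennreal_mult)
  also have "\<dots> = (\<integral>\<^sup>+s. (\<Sum>c\<in>C. ennreal (pmf (r s) c)) \<partial>law_X)"
    using rm by (intro nn_integral_sum[symmetric]) auto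
  also have "\<dots> = (\<integral>\<^sup>+s. 1 \<partial>law_X)"
  proof (rule nn_integral_cong)
    fix s assume "s \<in> space law_X"
    then have "set_pmf (r s) \<subseteq> C" using r by (simp add: pmf_kernel_def)
    then show "(\<Sum>c\<in>C. ennreal (pmf (r s) c)) = 1"
      using finite_labels by (simp add: sum_pmf_eq_1)
  qed
  also have "\<dots> = 1"
    using N.emeasure_space_1 by simp
  finally show ?thesis .
qed

text \<open>Gibbs' inequality. The bound \<open>ln t \<le> t - 1\<close> at \<open>t = r / k\<close> is used with the terms arranged so
  that both sides are nonnegative; hence no integrability is needed and \<open>r\<close> may vanish.\<close>

lemma nll_posterior_le:
  assumes r: "pmf_kernel C S r"
  shows "(\<integral>\<^sup>+w. nll (pmf (k (X w)) (Y w)) \<partial>M) \<le> (\<integral>\<^sup>+w. nll (pmf (r (X w)) (Y w)) \<partial>M)"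
proof -
  note [measurable] = kernel_measurable_comp[OF pmf_kernel_posterior] kernel_measurable_comp[OF r]
  let ?k = "\<lambda>w. pmf (k (X w)) (Y w)" and ?r = "\<lambda>w. pmf (r (X w)) (Y w)"
  have ineq: "nll a + 1 \<le> nll b + ennreal (b / a)" if "0 < a" "a \<le> 1" "0 \<le> b" "b \<le> 1" for a b :: real
  proof (cases "b = 0")
    case False
    with that have b: "0 < b" by simp
    have "- ln a + 1 \<le> - ln b + b / a"
      using ln_le_minus_one[of "b / a"] that b by (simp add: ln_div)
    then have "ennreal (- ln a + 1) \<le> ennreal (- ln b + b / a)"
      by (rule ennreal_leI)
    moreover have "ennreal (- ln a + 1) = nll a + 1" "ennreal (- ln b + b / a) = nll b + ennreal (b / a)"
      using that b by (subst ennreal_plus; simp add: nll_pos)+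
    ultimately show ?thesis by simp
  \<comment> \<open>In the remaining case \<open>b = 0\<close> the right-hand side is
    infinite.\<close>
  qed (simp add: nll_nonpos)
  have "AE w in M. nll (?k w) + 1 \<le> nll (?r w) + ennreal (?r w / ?k w)"
    using AE_posterior_pos by eventually_elim (rule ineq, auto simp: pmf_le_1)
  then have "(\<integral>\<^sup>+w. nll (?k w) + 1 \<partial>M) \<le> (\<integral>\<^sup>+w. nll (?r w) + ennreal (?r w / ?k w) \<partial>M)"
    by (rule nn_integral_mono_AE)
  then have "(\<integral>\<^sup>+w. nll (?k w) \<partial>M) + 1 \<le> (\<integral>\<^sup>+w. nll (?r w) \<partial>M) + (\<integral>\<^sup>+w. ennreal (?r w / ?k w) \<partial>M)"
    by (simp add: nn_integral_add emeasure_space_1)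
  also have "\<dots> \<le> (\<integral>\<^sup>+w. nll (?r w) \<partial>M) + 1"
    by (intro add_left_mono nn_integral_likelihood_ratio_le r)
  \<comment> \<open>The added 1 is finite, so it can be cancelled even if the integrals are
    infinite.\<close>
  finally show ?thesis
    by (simp add: add.commute[of _ 1] ennreal_add_left_cancel_le)
qed

text \<open>The uniform kernel has the constant value \<open>ln (card C)\<close> as its negative
  log-likelihood, and the posterior does no worse.\<close>

lemma nll_posterior_finite: "(\<integral>\<^sup>+w. nll (pmf (k (X w)) (Y w)) \<partial>M) < \<infinity>"
proof -
  \<comment> \<open>The uniform distribution needs a nonempty label set; a probability space has a
    point, and \<open>Y\<close> maps it into \<open>C\<close>.\<close>
  have ne: "C \<noteq> {}"
    using not_empty Y_in_labels by blast
  have "pmf_kernel C S (\<lambda>_. pmf_of_set C)"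
    using ne finite_labels by (auto simp: pmf_kernel_def)
  then have "(\<integral>\<^sup>+w. nll (pmf (k (X w)) (Y w)) \<partial>M) \<le> (\<integral>\<^sup>+w. nll (pmf (pmf_of_set C) (Y w)) \<partial>M)"
    by (rule nll_posterior_le)
  also have "\<dots> = (\<integral>\<^sup>+w. nll (1 / card C) \<partial>M)"
    using ne finite_labels Y_in_labels by (intro nn_integral_cong) simp
  also have "\<dots> < \<infinity>"
    using ne finite_labels by (simp add: emeasure_space_1 nll_pos card_gt_0_iff)
  finally show ?thesis .
qed


section \<open>The prior of the label and the mutual information\<close>

abbreviation "prior c \<equiv> measure law_Y {c}"

lemma prior_le_1: "prior c \<le> 1"
  by (rule prob_space.prob_le_1[OF prob_space_distr[OF Y]])

text \<open>The law of total probability, obtained from \<open>nn_integral_label\<close> with the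
  constant function 1.\<close>

lemma nn_integral_posterior:
  assumes c: "c \<in> C"
  shows "(\<integral>\<^sup>+s. ennreal (pmf (k s) c) \<partial>law_X) = ennreal (prior c)"
proof -
  have "(\<integral>\<^sup>+s. ennreal (pmf (k s) c) \<partial>law_X) = emeasure M {w \<in> space M. Y w = c}"
    using nn_integral_label[OF c, of "\<lambda>_. 1"] label_event[OF c] by simp
  also have "{w \<in> space M. Y w = c} = Y -` {c} \<inter> space M" by auto
  also have "emeasure M \<dots> = ennreal (prior c)"
    using c by (simp add: measure_distr emeasure_eq_measure)
  finally show ?thesis .
qed

text \<open>The integral is the entropy of \<open>Y\<close>, a finite sum. A label of prior 0 has
  infinite \<open>nll\<close>, but its term is 0 times \<infinity>, which is 0 in
  \<open>ennreal\<close>.\<close>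

lemma nll_prior_finite: "(\<integral>\<^sup>+w. nll (prior (Y w)) \<partial>M) < \<infinity>"
proof -
  have "(\<integral>\<^sup>+w. nll (prior (Y w)) \<partial>M)
    = (\<Sum>c\<in>C. \<integral>\<^sup>+s. ennreal (pmf (k s) c) * nll (prior c) \<partial>law_X)"
    by (rule nn_integral_joint[of "\<lambda>c _. nll (prior c)"]) simp
  also have "\<dots> = (\<Sum>c\<in>C. ennreal (prior c) * nll (prior c))"
    using posterior_measurable
    by (intro sum.cong) (auto simp: nn_integral_multc nn_integral_posterior)
  also have "\<dots> < \<infinity>"
  proof -
    have "ennreal (prior c) * nll (prior c) < \<infinity>" for c
      by (cases "prior c = 0")
        (auto simp: nll_pos zero_less_measure_iff ennreal_mult_less_top)
    then show ?thesis using finite_labels by simp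
  qed
  finally show ?thesis .
qed

lemma prior_measurable: "(\<lambda>w. prior (Y w)) \<in> borel_measurable M"
  by (rule measurable_compose[OF Y]) simp

text \<open>On each measurable set, both measures are reduced by \<open>nn_integral_joint\<close> to
  a sum over labels; the density is posterior over prior.\<close>

lemma joint_density:
  "distr M (count_space C \<Otimes>\<^sub>M S) (\<lambda>w. (Y w, X w))
    = density (law_Y \<Otimes>\<^sub>M law_X) (\<lambda>(y, x). ennreal (pmf (k x) y / prior y))" (is "?L = ?R")
proof (rule measure_eqI)
  interpret N: prob_space law_X by (rule prob_space_distr) (rule X)
  have dens[measurable]: "(\<lambda>(y, x). ennreal (pmf (k x) y / prior y))
      \<in> borel_measurable (count_space C \<Otimes>\<^sub>M S)"
    using posterior_measurable finite_labels
    by (intro measurable_pair_measure_countable1) (auto simp: countable_finite)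
  have sets: "sets (law_Y \<Otimes>\<^sub>M law_X) = sets (count_space C \<Otimes>\<^sub>M S)"
    by (intro sets_pair_measure_cong) auto
  then show "sets ?L = sets ?R" by simp
  fix A assume "A \<in> sets ?L"
  then have A[measurable]: "A \<in> sets (count_space C \<Otimes>\<^sub>M S)" by simp
  have slice[measurable]: "(\<lambda>s. indicator A (c, s) :: ennreal) \<in> borel_measurable S" if "c \<in> C" for c
    using that by (intro measurable_compose[OF measurable_Pair1' borel_measurable_indicator[OF A]]) simp
  have "emeasure ?L A = (\<integral>\<^sup>+z. indicator A z \<partial>?L)"
    by simp
  also have "\<dots> = (\<integral>\<^sup>+w. indicator A (Y w, X w) \<partial>M)"
    by (rule nn_integral_distr) auto
  also have "\<dots> = (\<Sum>c\<in>C. \<integral>\<^sup>+s. ennreal (pmf (k s) c) * indicator A (c, s) \<partial>law_X)"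
    by (rule nn_integral_joint[of "\<lambda>c s. indicator A (c, s)"]) (rule slice)
  also have "\<dots> = (\<Sum>c\<in>C. ennreal (prior c) *
      (\<integral>\<^sup>+s. ennreal (pmf (k s) c / prior c) * indicator A (c, s) \<partial>law_X))"
  proof (rule sum.cong[OF refl])
    fix c assume c: "c \<in> C"
    note [measurable] = posterior_measurable[OF c] slice[OF c]
    show "(\<integral>\<^sup>+s. ennreal (pmf (k s) c) * indicator A (c, s) \<partial>law_X)
      = ennreal (prior c) * (\<integral>\<^sup>+s. ennreal (pmf (k s) c / prior c) * indicator A (c, s) \<partial>law_X)"
    proof (cases "prior c = 0")
      case True
      \<comment> \<open>For a label of prior 0 the quotient carries no information, but the left
        side is dominated by the integrated posterior, which equals the prior and so is 0.\<close>
      have "(\<integral>\<^sup>+s. ennreal (pmf (k s) c) * indicator A (c, s) \<partial>law_X)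
        \<le> (\<integral>\<^sup>+s. ennreal (pmf (k s) c) \<partial>law_X)"
        by (intro nn_integral_mono) (auto split: split_indicator)
      with True show ?thesis by (simp add: nn_integral_posterior[OF c])
    next
      case False
      then show ?thesis
        by (subst nn_integral_cmult[symmetric])
          (auto intro!: nn_integral_cong split: split_indicator simp flip: ennreal_mult)
    qed
  qed
  \<comment> \<open>The factor \<open>prior c\<close> is rewritten as an integrated posterior, so
    that \<open>nn_integral_joint\<close> applies from right to left to a function of the label
    alone.\<close>
  also have "\<dots> = (\<Sum>c\<in>C. \<integral>\<^sup>+s'. ennreal (pmf (k s') c) *
      (\<integral>\<^sup>+s. ennreal (pmf (k s) c / prior c) * indicator A (c, s) \<partial>law_X) \<partial>law_X)"
    using posterior_measurable
    by (intro sum.cong) (auto simp: nn_integral_multc nn_integral_posterior)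
  also have "\<dots> = (\<integral>\<^sup>+w. \<integral>\<^sup>+s. ennreal (pmf (k s) (Y w) / prior (Y w)) * indicator A (Y w, s) \<partial>law_X \<partial>M)"
    by (rule nn_integral_joint[symmetric, of "\<lambda>c _. \<integral>\<^sup>+s. ennreal (pmf (k s) c / prior c) * indicator A (c, s) \<partial>law_X"])
      simp
  also have "\<dots> = (\<integral>\<^sup>+y. \<integral>\<^sup>+s. ennreal (pmf (k s) y / prior y) * indicator A (y, s) \<partial>law_X \<partial>law_Y)"
    by (rule nn_integral_distr[symmetric]) auto
  also have "\<dots> = (\<integral>\<^sup>+z. (case z of (y, x) \<Rightarrow> ennreal (pmf (k x) y / prior y)) * indicator A z \<partial>(law_Y \<Otimes>\<^sub>M law_X))"
    by (subst N.nn_integral_fst[symmetric])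
      (auto simp: measurable_cong_sets[OF sets refl])
  also have "\<dots> = emeasure ?R A"
    by (rule emeasure_density[symmetric]) (auto simp: measurable_cong_sets[OF sets refl] sets)
  finally show "emeasure ?L A = emeasure ?R A" .
qed

text \<open>The divergence is the integral of \<open>f * log f\<close> over the product law, with
  \<open>f\<close> the density of \<open>joint_density\<close>. Absorbing the factor
  \<open>f\<close> turns it into an integral over the joint law, which is pulled back to
  \<open>M\<close>.\<close>

lemma mutual_information_eq:
  "mutual_information (exp 1) (count_space C) S Y X
    = (\<integral>w. ln (pmf (k (X w)) (Y w)) \<partial>M) - (\<integral>w. ln (prior (Y w)) \<partial>M)"
proof -
  interpret N: prob_space law_X by (rule prob_space_distr) (rule X)
  interpret L: prob_space law_Y by (rule prob_space_distr) (rule Y)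
  interpret P: pair_prob_space law_Y law_X ..
  let ?f = "\<lambda>(y, x). pmf (k x) y / prior y"
  have sets: "sets (law_Y \<Otimes>\<^sub>M law_X) = sets (count_space C \<Otimes>\<^sub>M S)"
    by (intro sets_pair_measure_cong) auto
  have f: "?f \<in> borel_measurable (count_space C \<Otimes>\<^sub>M S)"
    using posterior_measurable finite_labels
    by (intro measurable_pair_measure_countable1) (auto simp: countable_finite)
  then have f': "?f \<in> borel_measurable (law_Y \<Otimes>\<^sub>M law_X)"
    by (simp add: measurable_cong_sets[OF sets refl])
  have J: "distr M (count_space C \<Otimes>\<^sub>M S) (\<lambda>w. (Y w, X w)) = density (law_Y \<Otimes>\<^sub>M law_X) (\<lambda>z. ennreal (?f z))"
    unfolding joint_density by (intro arg_cong[where f = "density _"]) (auto simp: fun_eq_iff)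
  have "mutual_information (exp 1) (count_space C) S Y X
    = (\<integral>z. ?f z * log (exp 1) (?f z) \<partial>(law_Y \<Otimes>\<^sub>M law_X))"
    unfolding mutual_information_def J using f' by (intro P.KL_density) auto
  also have "\<dots> = (\<integral>z. log (exp 1) (?f z) \<partial>density (law_Y \<Otimes>\<^sub>M law_X) (\<lambda>z. ennreal (?f z)))"
    using f' by (intro integral_real_density[symmetric]) auto
  also have "\<dots> = (\<integral>w. log (exp 1) (pmf (k (X w)) (Y w) / prior (Y w)) \<partial>M)"
    unfolding J[symmetric] using f by (subst integral_distr) auto
  also have "\<dots> = (\<integral>w. ln (pmf (k (X w)) (Y w)) - ln (prior (Y w)) \<partial>M)"
  proof (rule integral_cong_AE)
    note [measurable] = kernel_measurable_comp[OF pmf_kernel_posterior] prior_measurable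
    show "(\<lambda>w. log (exp 1) (pmf (k (X w)) (Y w) / prior (Y w))) \<in> borel_measurable M"
      "(\<lambda>w. ln (pmf (k (X w)) (Y w)) - ln (prior (Y w))) \<in> borel_measurable M"
      by measurable
    \<comment> \<open>The logarithm of the quotient is split where prior and posterior are both
      positive, which is almost everywhere.\<close>
    have "AE w in M. 0 < prior (Y w)"
      using prior_measurable prior_le_1 nll_prior_finite by (rule AE_pos_if_nll_finite)
    with AE_posterior_pos show "AE w in M. log (exp 1) (pmf (k (X w)) (Y w) / prior (Y w))
      = ln (pmf (k (X w)) (Y w)) - ln (prior (Y w))"
      by eventually_elim (simp add: log_def ln_div)
  qed
  \<comment> \<open>Separating the integrals requires both logarithms to be integrable; this follows
    from the two finiteness results for \<open>nll\<close>.\<close>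
  also have "\<dots> = (\<integral>w. ln (pmf (k (X w)) (Y w)) \<partial>M) - (\<integral>w. ln (prior (Y w)) \<partial>M)"
    by (intro Bochner_Integration.integral_diff integrable_ln_if_nll_finite
        kernel_measurable_comp pmf_kernel_posterior pmf_le_1 nll_posterior_finite
        prior_measurable prior_le_1 nll_prior_finite)
  finally show ?thesis .
qed

end

section \<open>Transfer to the laws and the chain of inequalities\<close>

lemma ext_expectation_distr_ln_ext:
  assumes "T \<in> measurable M N" "u \<in> borel_measurable N" "\<And>x. u x \<le> 1"
  shows "ext_expectation (distr M N T) (\<lambda>x. ln_ext (u x)) = ext_expectation M (\<lambda>w. ln_ext (u (T w)))"
  using assms by (simp add: ext_expectation_ln_ext nn_integral_distr)

theorem proposition1:
  fixes M :: "'w measure" and K :: nat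
    and Y :: "'w \<Rightarrow> nat"
    and A :: "'a measure" and Gsub :: "'w \<Rightarrow> 'a"
    and B :: "'b measure" and Gp :: "'w \<Rightarrow> 'b"
    and \<gamma> :: "'a \<times> 'b \<Rightarrow> real ^ 'd"
    and p_graphs :: "'a \<times> 'b \<Rightarrow> nat pmf"
    and p_\<gamma> q :: "real ^ 'd \<Rightarrow> nat pmf"
  defines "C \<equiv> {1..K}"
  defines "law_Y \<equiv> distr M (count_space C) Y"
    and "law_Y_graphs \<equiv>
      distr M (count_space C \<Otimes>\<^sub>M (A \<Otimes>\<^sub>M B)) (\<lambda>w. (Y w, (Gsub w, Gp w)))"
    and "I \<equiv> ereal (prob_space.mutual_information M (exp 1) (count_space C) (A \<Otimes>\<^sub>M B)
      Y (\<lambda>w. (Gsub w, Gp w)))"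
  assumes "prob_space M"
    and "Y \<in> measurable M (count_space C)"
    and "Gsub \<in> measurable M A"
    and "Gp \<in> measurable M B"
    and "\<gamma> \<in> borel_measurable (A \<Otimes>\<^sub>M B)"
    and "conditional_pmf M C Y (A \<Otimes>\<^sub>M B) (\<lambda>w. (Gsub w, Gp w)) p_graphs"
    and "conditional_pmf M C Y borel (\<lambda>w. \<gamma> (Gsub w, Gp w)) p_\<gamma>"
    and "pmf_kernel C borel q"
  shows "I = ext_expectation law_Y_graphs (\<lambda>(y, g). ln_ext (pmf (p_graphs g) y))
             - ext_expectation law_Y (\<lambda>y. ln_ext (measure law_Y {y})) \<and>
         ext_expectation law_Y_graphs (\<lambda>(y, g). ln_ext (pmf (p_graphs g) y))
             - ext_expectation law_Y (\<lambda>y. ln_ext (measure law_Y {y}))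
           \<ge> ext_expectation law_Y_graphs (\<lambda>(y, g). ln_ext (pmf (p_\<gamma> (\<gamma> g)) y))
             - ext_expectation law_Y (\<lambda>y. ln_ext (measure law_Y {y})) \<and>
         ext_expectation law_Y_graphs (\<lambda>(y, g). ln_ext (pmf (p_\<gamma> (\<gamma> g)) y))
             - ext_expectation law_Y (\<lambda>y. ln_ext (measure law_Y {y}))
           \<ge> ext_expectation law_Y_graphs (\<lambda>(y, g). ln_ext (pmf (q (\<gamma> g)) y)) \<and>
         I \<ge> - cls_loss law_Y_graphs (\<lambda>g. q (\<gamma> g))"
proof -
  note [measurable] = \<open>Y \<in> _\<close> \<open>Gsub \<in> _\<close> \<open>Gp \<in> _\<close> \<open>\<gamma> \<in> _\<close>
  let ?G = "\<lambda>w. (Gsub w, Gp w)"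
  interpret prob_space M by fact
  interpret G: label_posterior M C Y "A \<Otimes>\<^sub>M B" ?G p_graphs
    by unfold_locales (use assms in \<open>auto simp: C_def\<close>)
  interpret S: label_posterior M C Y borel "\<lambda>w. \<gamma> (?G w)" p_\<gamma>
    by unfold_locales (use assms in \<open>auto simp: C_def\<close>)
  \<comment> \<open>Composition with \<gamma> makes a kernel on the values of \<gamma> a competitor
    of \<open>p_graphs\<close>.\<close>
  have kernel_\<gamma>: "pmf_kernel C (A \<Otimes>\<^sub>M B) (\<lambda>g. r (\<gamma> g))" if "pmf_kernel C borel r" for r
    using that by (auto simp: pmf_kernel_def intro: measurable_compose[OF \<open>\<gamma> \<in> _\<close>])
  \<comment> \<open>Expectations are pulled back to \<open>M\<close>, where the instances
    \<open>G\<close> and \<open>S\<close> speak of the same quantities although their features have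
    different laws.\<close>
  define E where "E r = ext_expectation M (\<lambda>w. ln_ext (pmf (r (?G w)) (Y w)))" for r
  define H where "H = ext_expectation M (\<lambda>w. ln_ext (G.prior (Y w)))"
  have E: "ext_expectation law_Y_graphs (\<lambda>(y, g). ln_ext (pmf (r g) y)) = E r"
    if "pmf_kernel C (A \<Otimes>\<^sub>M B) r" for r
    using ext_expectation_distr_ln_ext[OF _ pmf_kernel_measurable[OF G.finite_labels that],
        of "\<lambda>w. (Y w, ?G w)" M]
    by (simp add: law_Y_graphs_def E_def case_prod_unfold pmf_le_1)
  have H: "ext_expectation law_Y (\<lambda>y. ln_ext (measure law_Y {y})) = H"
    unfolding law_Y_def H_def by (rule ext_expectation_distr_ln_ext) (auto simp: G.prior_le_1)
  have H_eq: "H = ereal (\<integral>w. ln (G.prior (Y w)) \<partial>M)"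
    unfolding H_def
    by (intro ext_expectation_ln_if_nll_finite G.prior_measurable G.prior_le_1 G.nll_prior_finite)
  have E_eq: "E p_graphs = ereal (\<integral>w. ln (pmf (p_graphs (?G w)) (Y w)) \<partial>M)"
    unfolding E_def
    by (intro ext_expectation_ln_if_nll_finite G.kernel_measurable_comp G.pmf_kernel_posterior
        pmf_le_1 G.nll_posterior_finite)
  have "H \<le> 0"
    unfolding H_def by (simp add: ext_expectation_ln_ext G.prior_le_1)
  \<comment> \<open>Both terms are real by \<open>E_eq\<close> and \<open>H_eq\<close>, so the
    extended difference is the real one.\<close>
  have I: "I = E p_graphs - H"
    by (simp add: I_def G.mutual_information_eq E_eq H_eq)
  have le1: "E (\<lambda>g. p_\<gamma> (\<gamma> g)) \<le> E p_graphs"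
    using G.nll_posterior_le[OF kernel_\<gamma>[OF S.pmf_kernel_posterior]]
    by (simp add: E_def ext_expectation_ln_ext pmf_le_1 less_eq_ennreal.rep_eq)
  have le2: "E (\<lambda>g. q (\<gamma> g)) \<le> E (\<lambda>g. p_\<gamma> (\<gamma> g))"
    using S.nll_posterior_le[OF \<open>pmf_kernel C borel q\<close>]
    by (simp add: E_def ext_expectation_ln_ext pmf_le_1 less_eq_ennreal.rep_eq)
  have mono: "E (\<lambda>g. p_\<gamma> (\<gamma> g)) - H \<le> E p_graphs - H"
    using le1 by (intro ereal_minus_mono) auto
  \<comment> \<open>Subtracting 0 on the left puts the claim in the form of monotonicity of
    subtraction, with \<open>H \<le> 0\<close>; this also covers the case that the expectation for
    \<open>q\<close> is -\<infinity>.\<close>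
  have "E (\<lambda>g. q (\<gamma> g)) - 0 \<le> E (\<lambda>g. p_\<gamma> (\<gamma> g)) - H"
    using le2 \<open>H \<le> 0\<close> by (intro ereal_minus_mono) auto
  then have last: "E (\<lambda>g. q (\<gamma> g)) \<le> E (\<lambda>g. p_\<gamma> (\<gamma> g)) - H"
    by simp
  show ?thesis
    unfolding cls_loss_def
    unfolding H E[OF G.pmf_kernel_posterior] E[OF kernel_\<gamma>[OF S.pmf_kernel_posterior]]
      E[OF kernel_\<gamma>[OF \<open>pmf_kernel C borel q\<close>]]
    using I mono last by simp
qed

end
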